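(* There exists a (finite) orthomodular lattice that satisfies the $n$OA law for $n=3,4,5,6$ but fails 3-Go. Consequently it fails $n$-Go for every $n\ge3$, and it does not satisfy all Mayet-Godowski equations.
   Context: Write $a\to b=a'\cup(a\cap b)$. The operation $\overset{(n)}{\equiv}$ is defined by $$a_1\overset{(3)}{\equiv}a_2=((a_1\to a_3)\cap(a_2\to a_3))\cup((a_1'\to a_3)\cap(a_2'\to a_3)),$$ $$a_1\overset{(n)}{\equiv}a_2=(a_1\overset{(n-1)}{\equiv}a_2)\cup((a_1\overset{(n-1)}{\equiv}a_n)\cap(a_2\overset{(n-1)}{\equiv}a_n))\quad (n\ge4).$$ In each subexpression only the two displayed variables are substituted; $a_3$ stays fixed. The $n$OA law is $(a_1\to a_3)\cap(a_1\overset{(n)}{\equiv}a_2)\le a_2\to a_3$. $n$-Go is $$(a_1\to a_2)\cap\cdots\cap(a_{n-1}\to a_n)\cap(a_n\to a_1)=(a_n\to a_{n-1})\cap\cdots\cap(a_2\to a_1)\cap(a_1\to a_n).$$ A Mayet-Godowski equation is a conditional equality $t_1\cap\cdots\cap t_n=u_1\cap\cdots\cap u_n$ ($n\ge2$). Each term is a variable or a join of distinct variables; the hypotheses are that variables within a term are mutually orthogonal ($x\le y'$); and each variable occurs equally often on both sides. *)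

theory Defs
  imports Main
begin

record 'a olat =
  carrier :: "'a set"
  meet :: "'a \<Rightarrow> 'a \<Rightarrow> 'a"
  join :: "'a \<Rightarrow> 'a \<Rightarrow> 'a"
  compl :: "'a \<Rightarrow> 'a"
  bot :: 'a
  top :: 'a

definition leq :: "'a olat \<Rightarrow> 'a \<Rightarrow> 'a \<Rightarrow> bool" where
  "leq L x y \<longleftrightarrow> meet L x y = x"

definition is_OML :: "'a olat \<Rightarrow> bool" where
  "is_OML L \<longleftrightarrow>
     bot L \<in> carrier L \<and> top L \<in> carrier L \<and>
     (\<forall>x\<in>carrier L. \<forall>y\<in>carrier L.
        meet L x y \<in> carrier L \<and> join L x y \<in> carrier L \<and>
        meet L x y = meet L y x \<and> join L x y = join L y x \<and>
        meet L x (join L x y) = x \<and> join L x (meet L x y) = x) \<and>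
     (\<forall>x\<in>carrier L. \<forall>y\<in>carrier L. \<forall>z\<in>carrier L.
        meet L x (meet L y z) = meet L (meet L x y) z \<and>
        join L x (join L y z) = join L (join L x y) z) \<and>
     (\<forall>x\<in>carrier L.
        meet L x (bot L) = bot L \<and> join L x (top L) = top L \<and>
        compl L x \<in> carrier L \<and>
        meet L x (compl L x) = bot L \<and> join L x (compl L x) = top L \<and>
        compl L (compl L x) = x) \<and>
     (\<forall>x\<in>carrier L. \<forall>y\<in>carrier L. leq L x y \<longrightarrow>
        leq L (compl L y) (compl L x) \<and>
        join L x (meet L (compl L x) y) = y)"

definition imp :: "'a olat \<Rightarrow> 'a \<Rightarrow> 'a \<Rightarrow> 'a" where
  "imp L a b = join L (compl L a) (meet L a b)"

text \<open>The operation x \<equiv>(n) y, where the remaining variables a3, a4, ..., an are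
  given by the valuation a (a i = a_i). Only the two displayed arguments are
  substituted in the recursion; a 3 stays fixed.\<close>
fun eqv :: "'a olat \<Rightarrow> nat \<Rightarrow> 'a \<Rightarrow> 'a \<Rightarrow> (nat \<Rightarrow> 'a) \<Rightarrow> 'a" where
  "eqv L n x y a =
    (if n \<le> 3 then
       join L (meet L (imp L x (a 3)) (imp L y (a 3)))
              (meet L (imp L (compl L x) (a 3)) (imp L (compl L y) (a 3)))
     else
       join L (eqv L (n - 1) x y a)
              (meet L (eqv L (n - 1) x (a n) a) (eqv L (n - 1) y (a n) a)))"

definition satisfies_nOA :: "'a olat \<Rightarrow> nat \<Rightarrow> bool" where
  "satisfies_nOA L n \<longleftrightarrow>
     (\<forall>a. (\<forall>i\<in>{1..n}. a i \<in> carrier L) \<longrightarrow>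
        leq L (meet L (imp L (a 1) (a 3)) (eqv L n (a 1) (a 2) a)) (imp L (a 2) (a 3)))"

fun go_fwd :: "'a olat \<Rightarrow> nat \<Rightarrow> (nat \<Rightarrow> 'a) \<Rightarrow> 'a" where
  "go_fwd L 0 a = top L"
| "go_fwd L (Suc 0) a = imp L (a 1) (a 2)"
| "go_fwd L (Suc (Suc k)) a =
     meet L (go_fwd L (Suc k) a) (imp L (a (Suc (Suc k))) (a (Suc (Suc (Suc k)))))"

fun go_bwd :: "'a olat \<Rightarrow> nat \<Rightarrow> (nat \<Rightarrow> 'a) \<Rightarrow> 'a" where
  "go_bwd L 0 a = top L"
| "go_bwd L (Suc 0) a = imp L (a 2) (a 1)"
| "go_bwd L (Suc (Suc k)) a =
     meet L (imp L (a (Suc (Suc (Suc k)))) (a (Suc (Suc k)))) (go_bwd L (Suc k) a)"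

definition satisfies_nGo :: "'a olat \<Rightarrow> nat \<Rightarrow> bool" where
  "satisfies_nGo L n \<longleftrightarrow>
     (\<forall>a. (\<forall>i\<in>{1..n}. a i \<in> carrier L) \<longrightarrow>
        meet L (go_fwd L (n - 1) a) (imp L (a n) (a 1)) =
        meet L (go_bwd L (n - 1) a) (imp L (a 1) (a n)))"

fun join_list :: "'a olat \<Rightarrow> 'a list \<Rightarrow> 'a" where
  "join_list L [] = bot L"
| "join_list L [x] = x"
| "join_list L (x # y # ys) = join L x (join_list L (y # ys))"

fun meet_list :: "'a olat \<Rightarrow> 'a list \<Rightarrow> 'a" where
  "meet_list L [] = top L"
| "meet_list L [x] = x"
| "meet_list L (x # y # ys) = meet L x (meet_list L (y # ys))"

text \<open>A Mayet-Godowski equation t1 \<inter> ... \<inter> tm = u1 \<inter> ... \<inter> um (m \<ge> 2): each term is a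
  nonempty list of distinct variables (natural-number indices), read as their join;
  every variable occurs equally often on both sides.\<close>
definition is_MG_equation :: "nat list list \<Rightarrow> nat list list \<Rightarrow> bool" where
  "is_MG_equation ts us \<longleftrightarrow>
     length ts = length us \<and> length ts \<ge> 2 \<and>
     (\<forall>t \<in> set (ts @ us). t \<noteq> [] \<and> distinct t) \<and>
     (\<forall>v. sum_list (map (\<lambda>t. count_list t v) ts) = sum_list (map (\<lambda>t. count_list t v) us))"

definition satisfies_MG :: "'a olat \<Rightarrow> nat list list \<Rightarrow> nat list list \<Rightarrow> bool" where
  "satisfies_MG L ts us \<longleftrightarrow>
     (\<forall>f. (\<forall>v. f v \<in> carrier L) \<longrightarrow>
        (\<forall>t \<in> set (ts @ us). \<forall>x \<in> set t. \<forall>y \<in> set t. x \<noteq> y \<longrightarrow> leq L (f x) (compl L (f y))) \<longrightarrow>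
        meet_list L (map (\<lambda>t. join_list L (map f t)) ts) =
        meet_list L (map (\<lambda>t. join_list L (map f t)) us))"

end

theory Submission
  imports Defs
begin

text \<open>
  The lattice is the 34-element Greechie lattice pasted from nine three-atom blocks: six blocks
  form a hexagon with corners \<open>a, \<dots>, f\<close> and third atoms \<open>X, Y, Z, W, U, V\<close>, and a hub \<open>p\<close>
  shares a block with each of \<open>X\<close>, \<open>Z\<close>, \<open>U\<close>. Going around the hexagon in one direction, the meet
  of the three joins \<open>a \<union> b\<close>, \<open>c \<union> d\<close>, \<open>e \<union> f\<close> is \<open>X' \<inter> Z' \<inter> U' = p\<close>, whereas
  \<open>b \<union> c\<close>, \<open>d \<union> e\<close>, \<open>f \<union> a\<close> meet in \<open>Y' \<inter> W' \<inter> V' = 0\<close>; this refutes 3-Go and a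
  Mayet-Godowski equation. Every \<open>n\<close>-Go implies 3-Go by letting \<open>a\<^sub>4 = \<dots> = a\<^sub>n = a\<^sub>1\<close>.

  The \<open>n\<close>OA laws follow, for all \<open>n\<close> at once, from one finite certificate per element \<open>c = a\<^sub>3\<close>:
  a lattice-valued relation \<open>g\<close> that dominates the operation \<open>\<equiv>\<^sup>(\<^sup>3\<^sup>)\<close>, is transitive in the sense
  \<open>g(x,d) \<inter> g(y,d) \<le> g(x,y)\<close>, and still satisfies \<open>(x \<rightarrow> c) \<inter> g(x,y) \<le> y \<rightarrow> c\<close>. By induction \<open>g\<close>
  dominates every \<open>\<equiv>\<^sup>(\<^sup>n\<^sup>)\<close>.
\<close>

section \<open>A sufficient condition for the nOA laws\<close>

lemma OML_closed:
  assumes "is_OML L" "x \<in> carrier L" "y \<in> carrier L"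
  shows "meet L x y \<in> carrier L" "join L x y \<in> carrier L" "compl L x \<in> carrier L"
    "imp L x y \<in> carrier L"
  using assms unfolding is_OML_def imp_def by blast+

lemma OML_meet_comm:
  assumes "is_OML L" "x \<in> carrier L" "y \<in> carrier L"
  shows "meet L x y = meet L y x"
  using assms unfolding is_OML_def by blast

lemma OML_meet_assoc:
  assumes "is_OML L" "x \<in> carrier L" "y \<in> carrier L" "z \<in> carrier L"
  shows "meet L x (meet L y z) = meet L (meet L x y) z"
  using assms unfolding is_OML_def by blast

lemma OML_meet_idem:
  assumes "is_OML L" "x \<in> carrier L"
  shows "meet L x x = x"
proof -
  have "join L x (meet L x x) = x" and "meet L x (join L x (meet L x x)) = x"
    using assms OML_closed[OF assms(1)] unfolding is_OML_def by blast+
  then show ?thesis by simp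
qed

lemma OML_leq_trans:
  assumes "is_OML L" "x \<in> carrier L" "y \<in> carrier L" "z \<in> carrier L"
    and "leq L x y" "leq L y z"
  shows "leq L x z"
  using OML_meet_assoc[OF assms(1-4)] assms(5,6) by (simp add: leq_def)

lemma OML_leq_meetI:
  assumes "is_OML L" "x \<in> carrier L" "y \<in> carrier L" "z \<in> carrier L"
    and "leq L x y" "leq L x z"
  shows "leq L x (meet L y z)"
  using OML_meet_assoc[OF assms(1-4)] assms(5,6) by (simp add: leq_def)

lemma OML_meet_leq:
  assumes "is_OML L" "x \<in> carrier L" "y \<in> carrier L"
  shows "leq L (meet L x y) x" "leq L (meet L x y) y"
proof -
  have *: "meet L y (meet L x y) = meet L x y" if "x \<in> carrier L" "y \<in> carrier L" for x y
    using OML_meet_assoc[OF assms(1) that(2,2,1)] OML_meet_comm[OF assms(1) that]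
      OML_meet_idem[OF assms(1) that(2)] by simp
  show "leq L (meet L x y) y"
    using *[OF assms(2,3)] OML_meet_comm[OF assms(1,3)] OML_closed[OF assms] by (simp add: leq_def)
  show "leq L (meet L x y) x"
    using *[OF assms(3,2)] OML_meet_comm[OF assms(1,2)] OML_meet_comm[OF assms]
      OML_closed[OF assms] by (simp add: leq_def)
qed

lemma OML_meet_mono:
  assumes "is_OML L" "x \<in> carrier L" "y \<in> carrier L" "x' \<in> carrier L" "y' \<in> carrier L"
    and "leq L x x'" "leq L y y'"
  shows "leq L (meet L x y) (meet L x' y')"
  using assms OML_closed[OF assms(1-3)] OML_meet_leq[OF assms(1-3)]
  by (meson OML_leq_meetI OML_leq_trans)

lemma OML_join_leq:
  assumes "is_OML L" "x \<in> carrier L" "y \<in> carrier L" "z \<in> carrier L"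
    and "leq L x z" "leq L y z"
  shows "leq L (join L x y) z"
proof -
  have j: "join L w z = z" if "w \<in> carrier L" "leq L w z" for w
  proof -
    have "join L z (meet L z w) = z" "meet L z w = meet L w z" "join L w z = join L z w"
      using assms(1,4) that(1) unfolding is_OML_def by blast+
    with that(2) show ?thesis by (simp add: leq_def)
  qed
  have "join L (join L x y) z = join L x (join L y z)"
    using assms(1-4) unfolding is_OML_def by metis
  then have "join L (join L x y) z = z"
    using j assms by simp
  moreover have "meet L (join L x y) (join L (join L x y) z) = join L x y"
    using assms(1-4) unfolding is_OML_def by blast
  ultimately show ?thesis by (simp add: leq_def)
qed

lemma satisfies_nOA_if_transitive_bound:
  fixes L :: "'a olat"
  defines "C \<equiv> carrier L"
  assumes oml: "is_OML L" and n: "n \<ge> 3"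
    and bound: "\<And>c. c \<in> C \<Longrightarrow> \<exists>g. \<forall>x\<in>C. \<forall>y\<in>C. g x y \<in> C \<and>
       leq L (join L (meet L (imp L x c) (imp L y c))
                (meet L (imp L (compl L x) c) (imp L (compl L y) c))) (g x y) \<and>
       leq L (meet L (imp L x c) (g x y)) (imp L y c) \<and>
       (\<forall>d\<in>C. leq L (meet L (g x d) (g y d)) (g x y))"
  shows "satisfies_nOA L n"
  unfolding satisfies_nOA_def
proof (intro allI impI)
  note closed = OML_closed[OF oml, folded C_def]
  fix a assume a: "\<forall>i\<in>{1..n}. a i \<in> carrier L"
  then have a123: "a 1 \<in> C" "a 2 \<in> C" "a 3 \<in> C"
    using n by (auto simp: C_def)
  obtain g where g0: "\<forall>x\<in>C. \<forall>y\<in>C. g x y \<in> C \<and>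
       leq L (join L (meet L (imp L x (a 3)) (imp L y (a 3)))
                (meet L (imp L (compl L x) (a 3)) (imp L (compl L y) (a 3)))) (g x y) \<and>
       leq L (meet L (imp L x (a 3)) (g x y)) (imp L y (a 3)) \<and>
       (\<forall>d\<in>C. leq L (meet L (g x d) (g y d)) (g x y))"
    using bound[OF a123(3)] by (elim exE)
  have g: "g x y \<in> C"
    and base: "leq L (join L (meet L (imp L x (a 3)) (imp L y (a 3)))
                (meet L (imp L (compl L x) (a 3)) (imp L (compl L y) (a 3)))) (g x y)"
    and law: "leq L (meet L (imp L x (a 3)) (g x y)) (imp L y (a 3))"
    if "x \<in> C" "y \<in> C" for x y
    using g0 that by blast+
  have trans: "leq L (meet L (g x d) (g y d)) (g x y)" if "x \<in> C" "y \<in> C" "d \<in> C" for x y d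
    using g0 that by blast
  have eqv_g: "eqv L k x y a \<in> C \<and> leq L (eqv L k x y a) (g x y)"
    if "k \<le> n" "x \<in> C" "y \<in> C" for k x y
    using that
  proof (induction k arbitrary: x y)
    \<comment> \<open>\<open>eqv\<close> treats every index up to 3 alike, so the induction can
      start at 0.\<close>
    case 0
    then show ?case using a123 base closed by (subst (1 2) eqv.simps) simp
  next
    case (Suc k)
    show ?case
    proof (cases "Suc k \<le> 3")
      case True
      then show ?thesis using Suc.prems a123 base closed by (subst (1 2) eqv.simps) simp
    next
      case False
      define d where "d = a (Suc k)"
      have d: "d \<in> C" using a False Suc.prems(1) by (auto simp: d_def C_def)
      have k: "k \<le> n" using Suc.prems(1) by simp
      note IH = Suc.IH[OF k]
      have xy: "x \<in> C" "y \<in> C" by fact+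
      have eq: "eqv L (Suc k) x y a = join L (eqv L k x y a)
          (meet L (eqv L k x d a) (eqv L k y d a))"
        using False by (subst eqv.simps) (simp add: d_def)
      have "leq L (meet L (eqv L k x d a) (eqv L k y d a)) (meet L (g x d) (g y d))"
        using IH xy d g by (intro OML_meet_mono[OF oml]) (auto simp: C_def)
      then have "leq L (meet L (eqv L k x d a) (eqv L k y d a)) (g x y)"
        using OML_leq_trans[OF oml, folded C_def, OF _ _ _ _ trans] closed IH xy d g by meson
      then show ?thesis
        unfolding eq using OML_join_leq[OF oml, folded C_def] closed IH xy d g by meson
    qed
  qed
  have "leq L (meet L (imp L (a 1) (a 3)) (eqv L n (a 1) (a 2) a))
              (meet L (imp L (a 1) (a 3)) (g (a 1) (a 2)))"
    using eqv_g[OF order_refl a123(1,2)] a123 g closed OML_meet_idem[OF oml]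
    by (intro OML_meet_mono[OF oml]) (auto simp: C_def leq_def)
  then show "leq L (meet L (imp L (a 1) (a 3)) (eqv L n (a 1) (a 2) a)) (imp L (a 2) (a 3))"
    using OML_leq_trans[OF oml, folded C_def, OF _ _ _ _ law] closed
      eqv_g[OF order_refl a123(1,2)] a123 g by meson
qed

section \<open>From n-Go to 3-Go\<close>

lemma OML_meet_top:
  assumes "is_OML L" "x \<in> carrier L"
  shows "meet L x (top L) = x"
proof -
  have "top L \<in> carrier L" "join L x (top L) = top L"
    using assms unfolding is_OML_def by blast+
  moreover have "meet L x (join L x (top L)) = x"
    using assms \<open>top L \<in> carrier L\<close> unfolding is_OML_def by blast
  ultimately show ?thesis by simp
qed

lemma OML_imp_self:
  assumes "is_OML L" "x \<in> carrier L"
  shows "imp L x x = top L"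
proof -
  have "join L x (compl L x) = top L" "compl L x \<in> carrier L"
    using assms unfolding is_OML_def by blast+
  moreover have "join L (compl L x) x = join L x (compl L x)"
    using assms \<open>compl L x \<in> carrier L\<close> unfolding is_OML_def by blast
  ultimately show ?thesis
    using OML_meet_idem[OF assms] by (simp add: imp_def)
qed

lemma OML_go_closed:
  assumes "is_OML L" "\<And>i. a i \<in> carrier L"
  shows "go_fwd L (Suc k) a \<in> carrier L" "go_bwd L (Suc k) a \<in> carrier L"
  using assms by (induction k) (simp_all add: OML_closed)

lemma satisfies_3Go_if_nGo:
  fixes L :: "'a olat"
  assumes oml: "is_OML L" and n: "n \<ge> 3" and go: "satisfies_nGo L n"
  shows "satisfies_nGo L 3"
  unfolding satisfies_nGo_def
proof (intro allI impI)
  fix a :: "nat \<Rightarrow> 'a" assume a: "\<forall>i\<in>{1..3}. a i \<in> carrier L"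
  \<comment> \<open>Repeating \<open>a 1\<close> from index 4 on turns the surplus implications into
    \<open>imp L (a 1) (a 1)\<close>, which is the top; index 0 gets \<open>a 1\<close> too, so
    \<open>b\<close> stays in the carrier everywhere.\<close>
  define b where "b i = (if i = 2 \<or> i = 3 then a i else a 1)" for i :: nat
  have b: "b i \<in> carrier L" for i
    using a by (auto simp: b_def)
  note closed = OML_closed[OF oml] OML_go_closed[OF oml b]
  have tail: "b (Suc (Suc (Suc (Suc k)))) = b 1" for k
    by (simp add: b_def)
  note step = tail OML_imp_self[OF oml] OML_meet_top[OF oml]
  have fwd: "meet L (go_fwd L (2 + k) b) (imp L (b (3 + k)) (b 1)) =
      meet L (go_fwd L 2 b) (imp L (b 3) (b 1))" for k
    using b by (induction k) (simp_all add: step closed numeral_2_eq_2 numeral_3_eq_3)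
  have bwd: "meet L (go_bwd L (2 + k) b) (imp L (b 1) (b (3 + k))) =
      meet L (go_bwd L 2 b) (imp L (b 1) (b 3))" for k
  proof (induction k)
    case (Suc k)
    \<comment> \<open>The backward meet grows at its front, so the former closing factor reappears
      there and is then commuted back.\<close>
    have "meet L (go_bwd L (2 + Suc k) b) (imp L (b 1) (b (3 + Suc k))) =
        meet L (imp L (b 1) (b (3 + k))) (go_bwd L (2 + k) b)"
      using b by (simp add: step closed numeral_2_eq_2 numeral_3_eq_3)
    also have "\<dots> = meet L (go_bwd L (2 + k) b) (imp L (b 1) (b (3 + k)))"
      using OML_meet_comm[OF oml] b closed by (simp add: numeral_2_eq_2)
    finally show ?case using Suc by simp
  qed simp
  obtain k where k: "n = 3 + k"
    using n le_Suc_ex by blast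
  have "meet L (go_fwd L (n - 1) b) (imp L (b n) (b 1)) =
      meet L (go_bwd L (n - 1) b) (imp L (b 1) (b n))"
    using go b unfolding satisfies_nGo_def by blast
  then have "meet L (go_fwd L 2 b) (imp L (b 3) (b 1)) = meet L (go_bwd L 2 b) (imp L (b 1) (b 3))"
    using fwd[of k] bwd[of k] by (simp add: k)
  then show "meet L (go_fwd L (3 - 1) a) (imp L (a 3) (a 1)) =
      meet L (go_bwd L (3 - 1) a) (imp L (a 1) (a 3))"
    by (simp add: numeral_2_eq_2 numeral_3_eq_3 b_def)
qed

section \<open>The lattice and its operation tables\<close>

primrec all_pairs :: "('a \<Rightarrow> 'b \<Rightarrow> bool) \<Rightarrow> 'a list \<Rightarrow> 'b list \<Rightarrow> bool" where
  "all_pairs r [] ys \<longleftrightarrow> True"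
| "all_pairs r (x # xs) ys \<longleftrightarrow> list_all (r x) ys \<and> all_pairs r xs ys"

lemma all_pairs_iff: "all_pairs r xs ys \<longleftrightarrow> (\<forall>x\<in>set xs. \<forall>y\<in>set ys. r x y)"
  by (induction xs) (auto simp: list_all_iff)

text \<open>
  Simplifying \<open>all_pairs (memoized f) xs ys\<close> with the definition of \<open>f\<close> evaluates every right-hand
  side \<open>f x y\<close> but leaves \<open>memo f x y\<close> alone, so the result is a table of ground rewrite rules for
  \<open>memo f\<close>. The attribute \<open>simplified\<close> with explicit rules has no congruence rule for \<open>if\<close> and
  visits all branches, and bodies under a binder are simplified again and again; hence the
  evaluated functions below are named constants that branch only linearly.
\<close>

definition memo :: "'a \<Rightarrow> 'a" where
  "memo f = f"

definition memoized :: "('a \<Rightarrow> 'b \<Rightarrow> 'c) \<Rightarrow> 'a \<Rightarrow> 'b \<Rightarrow> bool" where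
  "memoized f x y \<longleftrightarrow> memo f x y = f x y"

lemma tabulate: "all_pairs (memoized f) xs ys"
  by (simp add: all_pairs_iff memoized_def memo_def)

primrec mem :: "'a \<Rightarrow> 'a list \<Rightarrow> bool" where
  "mem x [] \<longleftrightarrow> False"
| "mem x (y # ys) \<longleftrightarrow> x = y \<or> mem x ys"

lemma mem_iff: "mem x ys \<longleftrightarrow> x \<in> set ys"
  by (induction ys) auto

lemmas eval_rules = simp_thms if_True if_False numeral_eq_iff eq_num_simps zero_neq_numeral
  numeral_neq_zero all_pairs.simps list.pred_inject append.simps mem.simps memoized_def

text \<open>
  Atoms are \<open>2, \<dots>, 17\<close>: the corners \<open>a, \<dots>, f\<close> are \<open>2, \<dots>, 7\<close>, the third atoms
  \<open>X, Y, Z, W, U, V\<close> are \<open>8, \<dots>, 13\<close>, the hub \<open>p\<close> is \<open>14\<close>, and \<open>15, 16, 17\<close> complete the spokes.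
  The complement of \<open>x\<close> is \<open>35 - x\<close>; leaving out \<open>1\<close> and \<open>34\<close> keeps every nonzero element a numeral.
\<close>

definition atoms :: "nat list" where
  "atoms = [2,3,4,5,6,7,8,9,10,11,12,13,14,15,16,17]"

definition coatoms :: "nat list" where
  "coatoms = [18,19,20,21,22,23,24,25,26,27,28,29,30,31,32,33]"

definition elems :: "nat list" where
  "elems = 0 # 35 # atoms @ coatoms"

lemmas elems_eval = elems_def atoms_def coatoms_def

definition blocks :: "nat list list" where
  "blocks = [[2,3,8], [3,4,9], [4,5,10], [5,6,11], [6,7,12], [7,2,13],
     [14,8,15], [14,10,16], [14,12,17]]"

definition neg :: "nat \<Rightarrow> nat" where
  "neg x = 35 - x"

lemma neg_table0: "list_all (\<lambda>x. neg x = 35 - x) elems"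
  by (simp add: neg_def list_all_iff)

lemmas neg_table = neg_table0[unfolded elems_eval, simplified]

primrec joined :: "nat \<Rightarrow> nat \<Rightarrow> nat list list \<Rightarrow> bool" where
  "joined x y [] \<longleftrightarrow> False"
| "joined x y (b # bs) \<longleftrightarrow> mem x b \<and> mem y b \<or> joined x y bs"

text \<open>Apart from equality and the bounds, only an atom lies below a coatom, namely when
  \<open>x\<close> and the atom \<open>neg y\<close> are distinct members of one block and hence
  orthogonal.\<close>

definition le0 :: "nat \<Rightarrow> nat \<Rightarrow> bool" where
  "le0 x y \<longleftrightarrow> x = y \<or> x = 0 \<or> y = 35 \<or> x \<noteq> neg y \<and> joined x (neg y) blocks"

abbreviation le :: "nat \<Rightarrow> nat \<Rightarrow> bool" where
  "le \<equiv> memo le0"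

lemmas le_table = tabulate[of le0 elems elems,
  simplified elems_eval le0_def blocks_def neg_table joined.simps eval_rules]

text \<open>The diagram has no loop of fewer than five blocks, so two incomparable elements have at
  most one common atom below them; the first hit is their meet, and 0 is the default.\<close>

primrec lower :: "nat list \<Rightarrow> nat \<Rightarrow> nat \<Rightarrow> nat" where
  "lower [] x y = 0"
| "lower (t # ts) x y = (if le t x \<and> le t y then t else lower ts x y)"

definition glb0 :: "nat \<Rightarrow> nat \<Rightarrow> nat" where
  "glb0 x y = (if le x y then x else if le y x then y else lower atoms x y)"

abbreviation glb :: "nat \<Rightarrow> nat \<Rightarrow> nat" where
  "glb \<equiv> memo glb0"

lemmas glb_table = tabulate[of glb0 elems elems,
  simplified elems_eval glb0_def lower.simps le_table eval_rules]

definition lub0 :: "nat \<Rightarrow> nat \<Rightarrow> nat" where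
  "lub0 x y = neg (glb (neg x) (neg y))"

abbreviation lub :: "nat \<Rightarrow> nat \<Rightarrow> nat" where
  "lub \<equiv> memo lub0"

lemmas lub_table = tabulate[of lub0 elems elems,
  simplified elems_eval lub0_def glb_table neg_table eval_rules]

definition impl0 :: "nat \<Rightarrow> nat \<Rightarrow> nat" where
  "impl0 x y = lub (neg x) (glb x y)"

abbreviation impl :: "nat \<Rightarrow> nat \<Rightarrow> nat" where
  "impl \<equiv> memo impl0"

lemmas impl_table = tabulate[of impl0 elems elems,
  simplified elems_eval impl0_def glb_table lub_table neg_table eval_rules]

lemmas table_rules = le_table glb_table lub_table impl_table neg_table eval_rules elems_eval

section \<open>Finite verification of the lattice laws\<close>

definition pair_ok :: "nat \<Rightarrow> nat \<Rightarrow> bool" where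
  "pair_ok x y \<longleftrightarrow> mem (glb x y) elems \<and> mem (impl x y) elems \<and> le (glb x y) x \<and>
     glb x y = glb y x \<and> (le x y \<and> le y x \<longrightarrow> x = y) \<and>
     (le x y \<longrightarrow> le (neg y) (neg x) \<and> lub x (glb (neg x) y) = y)"

definition triple_ok :: "nat \<Rightarrow> nat \<Rightarrow> nat \<Rightarrow> bool" where
  "triple_ok z x y \<longleftrightarrow>
     (le z x \<and> le z y \<longrightarrow> le z (glb x y)) \<and> (le z x \<and> le x y \<longrightarrow> le z y)"

definition triples_ok :: "nat \<Rightarrow> bool" where
  "triples_ok z \<longleftrightarrow> all_pairs (triple_ok z) elems elems"

definition elem_ok :: "nat \<Rightarrow> bool" where
  "elem_ok x \<longleftrightarrow> mem (neg x) elems \<and> neg (neg x) = x \<and> le x x \<and> le 0 x \<and>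
     glb x (neg x) = 0 \<and> (mem x (0 # atoms) \<or> mem (neg x) (0 # atoms))"

lemma pair_check: "all_pairs pair_ok elems elems"
  by (simp only: table_rules pair_ok_def)

lemma triple_check: "list_all triples_ok elems"
  by (simp only: table_rules triples_ok_def triple_ok_def)

lemma elem_check: "list_all elem_ok elems"
  by (simp only: table_rules elem_ok_def)

section \<open>The transitive bounds\<close>

primrec lookup :: "'k \<Rightarrow> ('k \<times> 'v list) list \<Rightarrow> 'v list" where
  "lookup k [] = []"
| "lookup k (e # es) = (if k = fst e then snd e else lookup k es)"

text \<open>
  The operation \<open>\<equiv>\<^sup>(\<^sup>3\<^sup>)\<close> itself is almost transitive: its transitive closure differs from it only
  through the pentagons formed by two spokes and the three hexagon blocks joining them. A triple
  \<open>(i, j, q)\<close> listed under \<open>c\<close> says that the closure takes the value \<open>q\<close> instead of \<open>0\<close> at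
  \<open>(i, j')\<close> and at the three pairs arising from it by exchanging or complementing both arguments.
\<close>

definition pentagons :: "(nat \<times> (nat \<times> nat \<times> nat) list) list" where
  "pentagons =
   [(2, [(9, 15, 10)]), (3, [(13, 15, 12)]), (4, [(11, 16, 12)]), (5, [(9, 16, 8)]),
    (6, [(13, 17, 8)]), (7, [(11, 17, 10)]), (9, [(2, 5, 14)]), (11, [(4, 7, 14)]),
    (13, [(3, 6, 14)]), (15, [(2, 16, 4), (3, 17, 7)]), (16, [(4, 17, 6), (5, 15, 3)]),
    (17, [(6, 15, 2), (7, 16, 5)]), (22, [(9, 15, 10), (11, 17, 10)]),
    (24, [(9, 16, 8), (13, 17, 8)]), (26, [(11, 16, 12), (13, 15, 12)]), (28, [(9, 15, 10)]),
    (29, [(9, 16, 8)]), (30, [(13, 17, 8)]), (31, [(13, 15, 12)]), (32, [(11, 16, 12)]),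
    (33, [(11, 17, 10)])]"

primrec extra :: "(nat \<times> nat \<times> nat) list \<Rightarrow> nat \<Rightarrow> nat \<Rightarrow> nat" where
  "extra [] x y = 0"
| "extra (p # ps) x y =
     (if x = fst p \<and> y = neg (fst (snd p)) \<or> y = fst p \<and> x = neg (fst (snd p)) \<or>
         neg x = fst p \<and> neg y = neg (fst (snd p)) \<or> neg y = fst p \<and> neg x = neg (fst (snd p))
      then snd (snd p) else extra ps x y)"

definition eqv3 :: "nat \<Rightarrow> nat \<Rightarrow> nat \<Rightarrow> nat" where
  "eqv3 c x y = lub (glb (impl x c) (impl y c)) (glb (impl (neg x) c) (impl (neg y) c))"

definition bnd :: "(nat \<times> nat \<times> nat) list \<Rightarrow> nat \<Rightarrow> nat \<Rightarrow> nat \<Rightarrow> nat" where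
  "bnd ps c x y = lub (eqv3 c x y) (extra ps x y)"

text \<open>
  Transitivity through \<open>d\<close> only concerns pairs of entries in the nonzero part of row \<open>d\<close>. Since the
  bound is symmetric and invariant under complementing both arguments, unordered pairs and one \<open>d\<close>
  from each complementary pair suffice.
\<close>

primrec cons_nonzero :: "nat \<Rightarrow> nat \<Rightarrow> (nat \<times> nat) list \<Rightarrow> (nat \<times> nat) list" where
  "cons_nonzero x 0 r = r"
| "cons_nonzero x (Suc v) r = (x, Suc v) # r"

lemma cons_nonzero_numeral: "cons_nonzero x (numeral k) r = (x, numeral k) # r"
  by (simp add: numeral_eq_Suc)

primrec row :: "(nat \<times> nat \<times> nat) list \<Rightarrow> nat \<Rightarrow> nat \<Rightarrow> nat list \<Rightarrow> (nat \<times> nat) list" where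
  "row ps c d [] = []"
| "row ps c d (x # xs) = cons_nonzero x (bnd ps c d x) (row ps c d xs)"

lemma set_row: "set (row ps c d xs) = {(x, bnd ps c d x) |x. x \<in> set xs \<and> bnd ps c d x \<noteq> 0}"
proof (induction xs)
  case (Cons x xs)
  then show ?case by (cases "bnd ps c d x") auto
qed simp

text \<open>\<open>p\<close> and \<open>q\<close> are entries \<open>(x, v)\<close> of one row
  \<open>d\<close>, with \<open>v\<close> the bound at \<open>(d, x)\<close>; thus \<open>d\<close>
  enters only through these values.\<close>

definition trans_ok :: "(nat \<times> nat \<times> nat) list \<Rightarrow> nat \<Rightarrow> nat \<times> nat \<Rightarrow> nat \<times> nat \<Rightarrow> bool" where
  "trans_ok ps c p q \<longleftrightarrow> le (glb (snd p) (snd q)) (bnd ps c (fst p) (fst q))"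

text \<open>The second conjunct serves row \<open>neg d\<close>, whose value at \<open>neg x\<close>
  is that of row \<open>d\<close> at \<open>x\<close>.\<close>

definition law_ok :: "nat \<Rightarrow> nat \<Rightarrow> nat \<times> nat \<Rightarrow> bool" where
  "law_ok c d p \<longleftrightarrow> le (glb (impl d c) (snd p)) (impl (fst p) c) \<and>
     le (glb (impl (neg d) c) (snd p)) (impl (neg (fst p)) c)"

primrec unordered_pairs :: "('a \<Rightarrow> 'a \<Rightarrow> bool) \<Rightarrow> 'a list \<Rightarrow> bool" where
  "unordered_pairs r [] \<longleftrightarrow> True"
| "unordered_pairs r (p # ps) \<longleftrightarrow> list_all (r p) (p # ps) \<and> unordered_pairs r ps"

lemma unordered_pairsD:
  "unordered_pairs r ps \<Longrightarrow> p \<in> set ps \<Longrightarrow> q \<in> set ps \<Longrightarrow> r p q \<or> r q p"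
  by (induction ps) (auto simp: list_all_iff)

text \<open>With the row as an argument, simplification evaluates it before it is
  duplicated.\<close>

definition row_ok :: "(nat \<times> nat \<times> nat) list \<Rightarrow> nat \<Rightarrow> nat \<Rightarrow> (nat \<times> nat) list \<Rightarrow> bool" where
  "row_ok ps c d r \<longleftrightarrow> list_all (law_ok c d) r \<and> unordered_pairs (trans_ok ps c) r"

definition row_ok_at :: "(nat \<times> nat \<times> nat) list \<Rightarrow> nat \<Rightarrow> nat \<Rightarrow> bool" where
  "row_ok_at ps c d \<longleftrightarrow> row_ok ps c d (row ps c d elems)"

definition triple_in :: "nat \<times> nat \<times> nat \<Rightarrow> bool" where
  "triple_in p \<longleftrightarrow> mem (fst p) elems \<and> mem (fst (snd p)) elems \<and> mem (snd (snd p)) elems"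

definition pentagons_ok :: "(nat \<times> nat \<times> nat) list \<Rightarrow> nat \<Rightarrow> bool" where
  "pentagons_ok ps c \<longleftrightarrow> list_all triple_in ps \<and> list_all (row_ok_at ps c) (0 # atoms)"

definition bound_ok :: "nat \<Rightarrow> bool" where
  "bound_ok c \<longleftrightarrow> pentagons_ok (lookup c pentagons) c"

lemmas bound_rules = table_rules bound_ok_def pentagons_ok_def triple_in_def row_ok_at_def row_ok_def unordered_pairs.simps
  law_ok_def trans_ok_def row.simps cons_nonzero_numeral cons_nonzero.simps(1) fst_conv snd_conv
  eqv3_def bnd_def extra.simps pentagons_def lookup.simps

lemma bound_check_bot_top: "list_all bound_ok [0, 35]"
  by (simp only: bound_rules)

lemma bound_check_atoms: "list_all bound_ok atoms"
  by (simp only: bound_rules)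

lemma bound_check_coatoms: "list_all bound_ok coatoms"
  by (simp only: bound_rules)

section \<open>The counterexample\<close>

definition wheel :: "nat olat" where
  "wheel = \<lparr>carrier = set elems, meet = glb, join = lub, compl = neg, bot = 0, top = 35\<rparr>"

lemma wheel_simps [simp]:
  "carrier wheel = set elems" "meet wheel = glb" "join wheel = lub" "compl wheel = neg"
  "bot wheel = 0" "top wheel = 35"
  by (simp_all add: wheel_def)

lemma lub_eq: "lub x y = neg (glb (neg x) (neg y))"
  by (simp add: memo_def lub0_def)

lemma impl_eq: "impl x y = lub (neg x) (glb x y)"
  by (simp add: memo_def impl0_def)

lemma imp_wheel: "imp wheel x y = impl x y"
  by (simp add: imp_def impl_eq)

lemma neg_facts:
  assumes "x \<in> set elems"
  shows "neg x \<in> set elems" "neg (neg x) = x" "le x x" "le 0 x" "glb x (neg x) = 0"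
    "x \<in> set (0 # atoms) \<or> neg x \<in> set (0 # atoms)"
  using elem_check assms unfolding list_all_iff elem_ok_def mem_iff by blast+

lemma pair_facts:
  assumes "x \<in> set elems" "y \<in> set elems"
  shows "glb x y \<in> set elems" "impl x y \<in> set elems" "le (glb x y) x" "glb x y = glb y x"
    "le x y \<Longrightarrow> le y x \<Longrightarrow> x = y" "le x y \<Longrightarrow> le (neg y) (neg x)"
    "le x y \<Longrightarrow> lub x (glb (neg x) y) = y"
  using pair_check assms unfolding all_pairs_iff pair_ok_def mem_iff by blast+

lemma glb_greatest:
  "z \<in> set elems \<Longrightarrow> x \<in> set elems \<Longrightarrow> y \<in> set elems \<Longrightarrow> le z x \<Longrightarrow> le z y \<Longrightarrow> le z (glb x y)"
  using triple_check unfolding list_all_iff triples_ok_def all_pairs_iff triple_ok_def by blast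

lemma le_trans:
  "x \<in> set elems \<Longrightarrow> y \<in> set elems \<Longrightarrow> z \<in> set elems \<Longrightarrow> le x y \<Longrightarrow> le y z \<Longrightarrow> le x z"
  using triple_check unfolding list_all_iff triples_ok_def all_pairs_iff triple_ok_def by blast

lemma glb_le2: "x \<in> set elems \<Longrightarrow> y \<in> set elems \<Longrightarrow> le (glb x y) y"
  using pair_facts(3)[of y x] pair_facts(4)[of x y] by simp

lemma glb_absorb: "le x y \<Longrightarrow> glb x y = x"
  by (simp add: memo_def glb0_def)

lemma leq_wheel: "x \<in> set elems \<Longrightarrow> y \<in> set elems \<Longrightarrow> leq wheel x y \<longleftrightarrow> le x y"
  using glb_le2[of x y] glb_absorb[of x y] by (auto simp: leq_def)

text \<open>Both sides are greatest lower bounds of the three elements; antisymmetry is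
  \<open>pair_facts(5)\<close>.\<close>

lemma glb_assoc:
  assumes xyz: "x \<in> set elems" "y \<in> set elems" "z \<in> set elems"
  shows "glb x (glb y z) = glb (glb x y) z"
proof (rule pair_facts(5))
  let ?l = "glb x (glb y z)" and ?r = "glb (glb x y) z"
  have yz: "glb y z \<in> set elems" and xy: "glb x y \<in> set elems"
    using pair_facts(1) xyz by blast+
  then show l: "?l \<in> set elems" and r: "?r \<in> set elems"
    using pair_facts(1) xyz by blast+
  have "le ?l (glb y z)" "le ?l x" "le ?r (glb x y)" "le ?r z"
    using glb_le2 pair_facts(3) xy yz xyz by blast+
  moreover from this have "le ?l y" "le ?l z" "le ?r x" "le ?r y"
    using le_trans l r xy yz xyz glb_le2[of y z] pair_facts(3)[of y z] glb_le2[of x y]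
      pair_facts(3)[of x y] by blast+
  ultimately show "le ?l ?r" "le ?r ?l"
    using glb_greatest l r xy yz xyz by blast+
qed

text \<open>As \<open>lub\<close> is the De Morgan dual of \<open>glb\<close>, the join laws reduce
  to facts about meets, order and complement; the orthomodular law was checked on all pairs.\<close>

lemma is_OML_wheel: "is_OML wheel"
proof -
  have bt: "0 \<in> set elems" "35 \<in> set elems" "neg 35 = 0" "neg 0 = 35"
    by (simp_all add: elems_def neg_def)
  have lub: "lub x y \<in> set elems" "lub x y = lub y x"
    if "x \<in> set elems" "y \<in> set elems" for x y
    using that neg_facts(1) pair_facts(1) pair_facts(4)[of "neg x" "neg y"]
    by (simp_all add: lub_eq)
  have absorb1: "glb x (lub x y) = x" if "x \<in> set elems" "y \<in> set elems" for x y
  proof (rule glb_absorb)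
    have "le (neg (neg x)) (neg (glb (neg x) (neg y)))"
      using that neg_facts(1) pair_facts(1,3,6) by meson
    then show "le x (lub x y)"
      using that by (simp add: neg_facts lub_eq)
  qed
  have absorb2: "lub x (glb x y) = x" if "x \<in> set elems" "y \<in> set elems" for x y
  proof -
    have "le (neg x) (neg (glb x y))"
      using that pair_facts(1,3,6) by meson
    then have "glb (neg x) (neg (glb x y)) = neg x"
      by (rule glb_absorb)
    then show ?thesis
      using that by (simp add: neg_facts lub_eq)
  qed
  have lub_assoc: "lub x (lub y z) = lub (lub x y) z"
    if "x \<in> set elems" "y \<in> set elems" "z \<in> set elems" for x y z
    using that neg_facts(1) pair_facts(1) glb_assoc[of "neg x" "neg y" "neg z"]
    by (simp add: lub_eq neg_facts)
  have glb_bot: "glb x 0 = 0" if "x \<in> set elems" for x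
    using that bt neg_facts(4) pair_facts(4)[of x 0] glb_absorb[of 0 x] by simp
  have lub_top: "lub x 35 = 35" if "x \<in> set elems" for x
    using that bt neg_facts(1) glb_bot by (simp add: lub_eq)
  have lub_neg: "lub x (neg x) = 35" if "x \<in> set elems" for x
    using that bt neg_facts(1) neg_facts(5)[of "neg x"] by (simp add: lub_eq)
  have leq: "leq wheel (neg y) (neg x)" "lub x (glb (neg x) y) = y"
    if "x \<in> set elems" "y \<in> set elems" "leq wheel x y" for x y
    using that neg_facts(1) pair_facts(6,7) by (simp_all add: leq_wheel)
  show ?thesis
    unfolding is_OML_def wheel_simps
    by (intro conjI ballI impI)
      (assumption | rule bt lub absorb1 absorb2 lub_assoc glb_bot lub_top lub_neg glb_assoc leq
        neg_facts(1,2,5) pair_facts(1,4))+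
qed

section \<open>The transitive bound for a fixed \<open>c\<close>\<close>

definition bound :: "nat \<Rightarrow> nat \<Rightarrow> nat \<Rightarrow> nat" where
  "bound c = bnd (lookup c pentagons) c"

context
  fixes c assumes c: "c \<in> set elems"
begin

lemma bound_ok: "bound_ok c"
  using c bound_check_bot_top bound_check_atoms bound_check_coatoms
  by (auto simp: elems_def list_all_iff)

lemma triples:
  assumes "(i, j, q) \<in> set (lookup c pentagons)"
  shows "i \<in> set elems" "j \<in> set elems" "q \<in> set elems"
  using bound_ok assms
  by (auto simp: bound_ok_def pentagons_ok_def list_all_iff triple_in_def mem_iff)

text \<open>The test in \<open>extra\<close> covers all four variants of a pair. Admitting any
  \<open>ps\<close> within the listed triples makes the induction go through.\<close>

lemma extra_conj:
  assumes "x \<in> set elems" "y \<in> set elems" "set ps \<subseteq> set (lookup c pentagons)"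
  shows "extra ps x y \<in> set elems \<and> extra ps x y = extra ps y x \<and>
    extra ps (neg x) (neg y) = extra ps x y"
  using assms(3)
proof (induction ps)
  case Nil
  show ?case by (simp add: elems_def)
next
  case (Cons p ps)
  obtain i j q where p: "p = (i, j, q)" by (cases p)
  then have "q \<in> set elems"
    using triples Cons.prems by auto
  with Cons p show ?case
    using assms(1,2) by (auto simp: neg_facts)
qed

lemmas extra_facts = extra_conj[OF _ _ order_refl, THEN conjunct1]
  extra_conj[OF _ _ order_refl, THEN conjunct2, THEN conjunct1]
  extra_conj[OF _ _ order_refl, THEN conjunct2, THEN conjunct2]

lemma bound_closed:
  assumes "x \<in> set elems" "y \<in> set elems"
  shows "bound c x y \<in> set elems"
  unfolding bound_def bnd_def eqv3_def lub_eq
  using assms c extra_facts(1)[OF assms]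
  by (intro neg_facts(1) pair_facts(1,2)) auto

lemma bound_sym:
  assumes "x \<in> set elems" "y \<in> set elems"
  shows "bound c x y = bound c y x"
proof -
  have "impl x c \<in> set elems" "impl y c \<in> set elems"
    "impl (neg x) c \<in> set elems" "impl (neg y) c \<in> set elems"
    using assms c neg_facts(1) pair_facts(2) by blast+
  then have "eqv3 c x y = eqv3 c y x"
    unfolding eqv3_def by (metis pair_facts(4))
  then show ?thesis
    using extra_facts(2)[OF assms] by (simp add: bound_def bnd_def)
qed

text \<open>Complementing both arguments swaps the two joinands of \<open>eqv3\<close>.\<close>

lemma bound_neg:
  assumes "x \<in> set elems" "y \<in> set elems"
  shows "bound c (neg x) (neg y) = bound c x y"
proof -
  have "impl x c \<in> set elems" "impl y c \<in> set elems"
    "impl (neg x) c \<in> set elems" "impl (neg y) c \<in> set elems"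
    using assms c neg_facts(1) pair_facts(2) by blast+
  then have "eqv3 c (neg x) (neg y) = eqv3 c x y"
    unfolding eqv3_def lub_eq using assms
    by (simp add: neg_facts) (metis neg_facts(1) pair_facts(1,4))
  then show ?thesis
    using extra_facts(3)[OF assms] by (simp add: bound_def bnd_def)
qed

lemma eqv3_le_bound:
  assumes "x \<in> set elems" "y \<in> set elems"
  shows "le (eqv3 c x y) (bound c x y)"
proof -
  have "eqv3 c x y \<in> set elems"
    unfolding eqv3_def lub_eq using assms c by (intro neg_facts(1) pair_facts(1,2))
  then have "glb (eqv3 c x y) (bound c x y) = eqv3 c x y"
    using is_OML_wheel extra_facts(1)[OF assms]
    by (simp add: is_OML_def bound_def bnd_def)
  then show ?thesis
    using \<open>eqv3 c x y \<in> set elems\<close> bound_closed[OF assms] glb_le2 by metis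
qed

lemma bound_row:
  assumes d: "d \<in> set (0 # atoms)" and xy: "x \<in> set elems" "y \<in> set elems"
  shows "le (glb (bound c d x) (bound c d y)) (bound c x y)"
    "le (glb (impl d c) (bound c d x)) (impl x c)"
    "le (glb (impl (neg d) c) (bound c d x)) (impl (neg x) c)"
proof -
  define r where "r = row (lookup c pentagons) c d elems"
  have dE: "d \<in> set elems" using d by (auto simp: elems_def)
  have E: "bound c d x \<in> set elems" "bound c d y \<in> set elems"
    "bound c x y \<in> set elems" "impl d c \<in> set elems" "impl x c \<in> set elems"
    "impl (neg d) c \<in> set elems" "impl (neg x) c \<in> set elems"
    using dE xy c bound_closed neg_facts(1) pair_facts(2) by blast+
  have zero: "glb 0 z = 0" "glb z 0 = 0" "le 0 z" if "z \<in> set elems" for z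
    using that neg_facts(4) glb_absorb[of 0 z] pair_facts(4)[of 0 z]
    by (simp_all add: elems_def)
  have ok: "row_ok (lookup c pentagons) c d r"
    using bound_ok d
    by (auto simp: bound_ok_def pentagons_ok_def list_all_iff row_ok_at_def r_def)
  have r: "set r = {(z, bound c d z) |z. z \<in> set elems \<and> bound c d z \<noteq> 0}"
    by (simp add: r_def set_row bound_def)
  \<comment> \<open>An entry missing from the row has value 0, which makes the meet 0; the others
    are covered by \<open>law_ok\<close>.\<close>
  show "le (glb (impl d c) (bound c d x)) (impl x c)"
    "le (glb (impl (neg d) c) (bound c d x)) (impl (neg x) c)"
    using ok xy zero E
    by (cases "bound c d x = 0"; force simp: row_ok_def list_all_iff law_ok_def r)+
  show "le (glb (bound c d x) (bound c d y)) (bound c x y)"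
  proof (cases "bound c d x = 0 \<or> bound c d y = 0")
    case True
    then show ?thesis using zero E by auto
  next
    case False
    then have "(x, bound c d x) \<in> set r" "(y, bound c d y) \<in> set r"
      using xy by (auto simp: r)
    \<comment> \<open>Only one order of the two entries was checked; symmetry of meet and bound
      supplies the other.\<close>
    with ok have "trans_ok (lookup c pentagons) c (x, bound c d x) (y, bound c d y) \<or>
        trans_ok (lookup c pentagons) c (y, bound c d y) (x, bound c d x)"
      unfolding row_ok_def using unordered_pairsD by metis
    then show ?thesis
      using pair_facts(4)[OF E(1,2)] bound_sym[OF xy]
      by (auto simp: trans_ok_def bound_def)
  qed
qed

text \<open>Either \<open>d\<close> or \<open>neg d\<close> is in \<open>0 # atoms\<close>. In the
  latter case \<open>bound_row\<close> at the complements gives the claims through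
  \<open>bound_neg\<close>.\<close>

lemma bound_trans_law:
  assumes d: "d \<in> set elems" and xy: "x \<in> set elems" "y \<in> set elems"
  shows "le (glb (bound c d x) (bound c d y)) (bound c x y)"
    "le (glb (impl d c) (bound c d x)) (impl x c)"
  using neg_facts(6)[OF d] bound_row[of d x y] bound_row[of "neg d" "neg x" "neg y"]
    neg_facts(1,2) bound_neg d xy by auto

end

lemma satisfies_nOA_wheel:
  assumes "n \<ge> 3"
  shows "satisfies_nOA wheel n"
proof (rule satisfies_nOA_if_transitive_bound[OF is_OML_wheel assms], unfold wheel_simps imp_wheel)
  fix c assume c: "c \<in> set elems"
  show "\<exists>g. \<forall>x\<in>set elems. \<forall>y\<in>set elems. g x y \<in> set elems \<and>
       leq wheel (lub (glb (impl x c) (impl y c)) (glb (impl (neg x) c) (impl (neg y) c))) (g x y) \<and>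
       leq wheel (glb (impl x c) (g x y)) (impl y c) \<and>
       (\<forall>d\<in>set elems. leq wheel (glb (g x d) (g y d)) (g x y))"
  proof (intro exI[of _ "bound c"] ballI conjI)
    fix x y assume xy: "x \<in> set elems" "y \<in> set elems"
    have E: "impl x c \<in> set elems" "impl y c \<in> set elems"
      "impl (neg x) c \<in> set elems" "impl (neg y) c \<in> set elems"
      using xy c neg_facts(1) pair_facts(2) by blast+
    show b: "bound c x y \<in> set elems" by (rule bound_closed[OF c xy])
    have "lub (glb (impl x c) (impl y c)) (glb (impl (neg x) c) (impl (neg y) c)) \<in> set elems"
      using E pair_facts(1) OML_closed(2)[OF is_OML_wheel] by simp
    then show "leq wheel (lub (glb (impl x c) (impl y c)) (glb (impl (neg x) c) (impl (neg y) c)))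
        (bound c x y)"
      using eqv3_le_bound[OF c xy] b by (simp add: leq_wheel eqv3_def)
    show "leq wheel (glb (impl x c) (bound c x y)) (impl y c)"
      using bound_trans_law(2)[OF c xy(1,2,2)] E b pair_facts(1) by (simp add: leq_wheel)
    fix d assume d: "d \<in> set elems"
    show "leq wheel (glb (bound c x d) (bound c y d)) (bound c x y)"
      using bound_trans_law(1)[OF c d xy] bound_sym[OF c _ d] bound_closed[OF c] b xy d
        pair_facts(1) by (simp add: leq_wheel)
  qed
qed

section \<open>Failure of 3-Go and of a Mayet-Godowski equation\<close>

lemma not_satisfies_3Go_wheel: "\<not> satisfies_nGo wheel 3"
proof
  assume *: "satisfies_nGo wheel 3"
  \<comment> \<open>The values are \<open>b', d', f'\<close>. As \<open>b' \<inter> d' = c\<close>,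
    one gets \<open>b' \<rightarrow> d' = b \<union> c\<close> and
    \<open>d' \<rightarrow> b' = c \<union> d\<close>, and likewise around the hexagon, so the
    forward meet is 0 and the backward one is \<open>p\<close>.\<close>
  define a :: "nat \<Rightarrow> nat" where "a i = (if i = 1 then 32 else if i = 2 then 30 else 28)" for i
  have "a i \<in> set elems" for i
    by (simp add: a_def elems_eval)
  then have "glb (go_fwd wheel (3 - 1) a) (impl (a 3) (a 1)) =
      glb (go_bwd wheel (3 - 1) a) (impl (a 1) (a 3))"
    using * unfolding satisfies_nGo_def wheel_simps imp_wheel by blast
  then have "glb (glb (impl 32 30) (impl 30 28)) (impl 28 32) =
      glb (glb (impl 28 30) (impl 30 32)) (impl 32 28)"
    by (simp add: a_def numeral_2_eq_2 numeral_3_eq_3 imp_wheel)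
  then show False
    by (simp only: table_rules)
qed

text \<open>Variables 0 to 5 stand for the hexagon corners in cyclic order; each side uses every
  second edge.\<close>

lemma is_MG_equation_hexagon: "is_MG_equation [[0,1],[2,3],[4,5]] [[1,2],[3,4],[5,0]]"
  by (simp add: is_MG_equation_def)

lemma not_satisfies_MG_wheel: "\<not> satisfies_MG wheel [[0,1],[2,3],[4,5]] [[1,2],[3,4],[5,0]]"
proof
  assume *: "satisfies_MG wheel [[0,1],[2,3],[4,5]] [[1,2],[3,4],[5,0]]"
  \<comment> \<open>Corners are the atoms 2 to 7; the value 2 elsewhere only keeps \<open>f\<close>
    in the carrier.\<close>
  define f :: "nat \<Rightarrow> nat" where "f v = (if v \<le> 5 then v + 2 else 2)" for v
  have f: "f 0 = 2" "f 1 = 3" "f 2 = 4" "f 3 = 5" "f 4 = 6" "f 5 = 7" "f (Suc 0) = 3"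
    by (simp_all add: f_def)
  have f_range: "f v \<in> set elems" for v
    by (auto simp: f_def elems_eval le_Suc_eq numeral_eq_Suc)
  have orth: "leq wheel 2 (neg 3)" "leq wheel 3 (neg 2)" "leq wheel 3 (neg 4)" "leq wheel 4 (neg 3)"
    "leq wheel 4 (neg 5)" "leq wheel 5 (neg 4)" "leq wheel 5 (neg 6)" "leq wheel 6 (neg 5)"
    "leq wheel 6 (neg 7)" "leq wheel 7 (neg 6)" "leq wheel 7 (neg 2)" "leq wheel 2 (neg 7)"
    by (simp_all only: leq_def wheel_simps table_rules)
  have "glb (lub 2 3) (glb (lub 4 5) (lub 6 7)) = glb (lub 3 4) (glb (lub 5 6) (lub 7 2))"
    using * f_range orth unfolding satisfies_MG_def wheel_simps
    by (elim allE[of _ f]) (simp add: f)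
  then show False
    by (simp only: table_rules)
qed

theorem theorem6p9:
  shows "\<exists>L :: nat olat. finite (carrier L) \<and> is_OML L \<and>
           (\<forall>n\<in>{3,4,5,6}. satisfies_nOA L n) \<and>
           \<not> satisfies_nGo L 3 \<and>
           (\<forall>n\<ge>3. \<not> satisfies_nGo L n) \<and>
           (\<exists>ts us. is_MG_equation ts us \<and> \<not> satisfies_MG L ts us)"
proof (intro exI[of _ wheel] conjI)
  show "finite (carrier wheel)" by simp
  show "is_OML wheel" by (rule is_OML_wheel)
  show "\<forall>n\<in>{3,4,5,6}. satisfies_nOA wheel n" by (simp add: satisfies_nOA_wheel)
  show "\<not> satisfies_nGo wheel 3" by (rule not_satisfies_3Go_wheel)
  then show "\<forall>n\<ge>3. \<not> satisfies_nGo wheel n"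
    using satisfies_3Go_if_nGo[OF is_OML_wheel] by blast
  show "\<exists>ts us. is_MG_equation ts us \<and> \<not> satisfies_MG wheel ts us"
    using is_MG_equation_hexagon not_satisfies_MG_wheel by blast
qed

end
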